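(* Let $1\le d\le \ell\le k-1$ be integers and put $t=k-d$. Then, for $n$ divisible by $k-\ell$, \[ h_d^{\ell}(k,n) \ge \left( 1 - b_{t, k-\ell}\, 2^{-t} + o(1) \right)\binom nt, \] where $b_{t,k-\ell}$ is the largest sum of $k-\ell$ consecutive binomial coefficients from $\binom t0,\dots,\binom tt$, and $o(1)$ denotes a quantity tending to $0$ as $n\to\infty$.
   Context: A $k$-uniform hypergraph ($k$-graph) $H$ consists of a vertex set $V$ and an edge set $E\subseteq\binom{V}{k}$. For a set $S$ of $d$ vertices ($1\le d\le k-1$), $\deg_H(S)$ is the number of edges containing $S$, and the minimum $d$-degree $\delta_d(H)$ is the minimum of $\deg_H(S)$ over all $d$-vertex sets $S$. For $1\le \ell\le k-1$, a $k$-graph is an $\ell$-cycle if its vertices can be ordered cyclically so that each edge consists of $k$ consecutive vertices and every two consecutive edges (in the natural order of the edges) share exactly $\ell$ vertices. A Hamilton $\ell$-cycle of $H$ is a spanning subhypergraph that is an $\ell$-cycle. For $n$ divisible by $k-\ell$, $h_d^\ell(k,n)$ is the smallest integer $h$ such that every $n$-vertex $k$-graph $H$ with $\delta_d(H)\ge h$ contains a Hamilton $\ell$-cycle. *)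

theory Defs
  imports Complex_Main "HOL-Library.Ramsey"
begin

definition kgraph :: "nat \<Rightarrow> 'a set \<Rightarrow> 'a set set \<Rightarrow> bool" where
  "kgraph k V E \<longleftrightarrow> finite V \<and> E \<subseteq> nsets V k"

definition hdegree :: "'a set set \<Rightarrow> 'a set \<Rightarrow> nat" where
  "hdegree E S = card {e \<in> E. S \<subseteq> e}"

definition min_degree :: "nat \<Rightarrow> 'a set \<Rightarrow> 'a set set \<Rightarrow> nat" where
  "min_degree d V E = Min (hdegree E ` nsets V d)"

text \<open>The \<open>k\<close> cyclically consecutive vertices starting at position \<open>a\<close>
  of the cyclic order \<open>v 0, \<dots>, v (n - 1)\<close>.\<close>

definition cyclic_segment :: "(nat \<Rightarrow> 'a) \<Rightarrow> nat \<Rightarrow> nat \<Rightarrow> nat \<Rightarrow> 'a set" where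
  "cyclic_segment v n k a = (\<lambda>j. v ((a + j) mod n)) ` {..<k}"

text \<open>The natural order of the edges is the order of their starting positions \<open>s i\<close>, and the last
  edge is followed by the first. A cycle has at least one edge and no isolated vertices: otherwise
  two overlapping edges together with arbitrarily many isolated vertices would be a cycle.\<close>

definition l_cycle :: "nat \<Rightarrow> nat \<Rightarrow> 'a set \<Rightarrow> 'a set set \<Rightarrow> bool" where
  "l_cycle k l V C \<longleftrightarrow> kgraph k V C \<and> C \<noteq> {} \<and> \<Union>C = V \<and>
     (\<exists>v s. bij_betw v {..<card V} V \<and>
        strict_mono_on {..<card C} s \<and> s ` {..<card C} \<subseteq> {..<card V} \<and>
        C = (\<lambda>i. cyclic_segment v (card V) k (s i)) ` {..<card C} \<and>
        (\<forall>i<card C. card (cyclic_segment v (card V) k (s i) \<inter>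
                          cyclic_segment v (card V) k (s ((i + 1) mod card C))) = l))"

definition has_hamilton_l_cycle :: "nat \<Rightarrow> nat \<Rightarrow> 'a set \<Rightarrow> 'a set set \<Rightarrow> bool" where
  "has_hamilton_l_cycle k l V E \<longleftrightarrow> (\<exists>C \<subseteq> E. l_cycle k l V C)"

text \<open>The threshold \<open>h\<^sub>d\<^sup>l(k,n)\<close>. Up to isomorphism, all hypergraphs on \<open>n\<close> vertices have their
  vertices among the natural numbers.\<close>

definition hamilton_threshold :: "nat \<Rightarrow> nat \<Rightarrow> nat \<Rightarrow> nat \<Rightarrow> nat" where
  "hamilton_threshold d l k n =
     (LEAST h. \<forall>(V :: nat set) E. kgraph k V E \<and> card V = n \<and> min_degree d V E \<ge> h
        \<longrightarrow> has_hamilton_l_cycle k l V E)"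

definition max_binomial_sum :: "nat \<Rightarrow> nat \<Rightarrow> nat" where
  "max_binomial_sum t m = Max {(\<Sum>i = j..<j + m. t choose i) | j. j + m \<le> t + 1}"

end

theory Submission
  imports Defs "HOL-Number_Theory.Cong" "HOL-Real_Asymp.Real_Asymp"
begin

text \<open>Let \<open>A\<close> be half of the \<open>n\<close> vertices, \<open>m = k - l\<close>, and let the edges be all \<open>k\<close>-sets \<open>e\<close> for which
  \<open>card (e \<inter> A)\<close> avoids a window of \<open>m\<close> consecutive values. Consecutive edges of an \<open>l\<close>-cycle
  differ in \<open>m\<close> vertices, so along a Hamilton \<open>l\<close>-cycle \<open>card (e \<inter> A)\<close> stays below the window or stays
  above it. Every vertex lies in at least \<open>q = k div m\<close> of the \<open>n / m\<close> edges, so the averages of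
  \<open>card (e \<inter> A)\<close> and \<open>card (e - A)\<close> are at least about \<open>q * m / 2\<close>; a window starting at
  \<open>\<lceil>q * m / 2\<rceil>\<close> contradicts both alternatives. For a \<open>d\<close>-set \<open>S\<close>, the intersection of a random \<open>t\<close>-set
  with \<open>A\<close> is asymptotically binomial, so at most a proportion \<open>b / 2 ^ t + o(1)\<close> of the \<open>t\<close>-sets is
  lost to the window, where \<open>b\<close> is the largest sum of \<open>m\<close> consecutive binomial coefficients.\<close>

section \<open>Cyclic segments\<close>

lemma add_mod_inj:
  fixes a x y n :: nat
  assumes "x < n" "y < n" "(a + x) mod n = (a + y) mod n"
  shows "x = y"
proof -
  have "[a + x = a + y] (mod n)"
    using assms(3) by (simp add: Cong.cong_def)
  then have "[x = y] (mod n)"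
    by (simp only: cong_add_lcancel_nat)
  then show ?thesis
    using assms by (simp add: Cong.cong_def)
qed

lemma inj_on_cyclic_shift:
  fixes a n :: nat
  assumes v: "bij_betw v {..<n} V"
  shows "inj_on (\<lambda>x. v ((a + x) mod n)) {..<n}"
proof (rule inj_onI)
  fix x y assume xy: "x \<in> {..<n}" "y \<in> {..<n}" and eq: "v ((a + x) mod n) = v ((a + y) mod n)"
  have "(a + x) mod n \<in> {..<n}" "(a + y) mod n \<in> {..<n}"
    using xy by auto
  then have "(a + x) mod n = (a + y) mod n"
    using v eq by (auto simp: bij_betw_def dest: inj_onD)
  then show "x = y"
    using add_mod_inj xy by auto
qed

lemma bij_betw_cyclic_shift:
  fixes a n :: nat
  assumes v: "bij_betw v {..<n} V"
  shows "bij_betw (\<lambda>x. v ((a + x) mod n)) {..<n} V"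
proof -
  have fin: "finite V" and c: "card V = n"
    using v bij_betw_finite bij_betw_same_card by fastforce+
  have sub: "(\<lambda>x. v ((a + x) mod n)) ` {..<n} \<subseteq> V"
    using v by (auto simp: bij_betw_def)
  have "card ((\<lambda>x. v ((a + x) mod n)) ` {..<n}) = card V"
    using card_image[OF inj_on_cyclic_shift[OF v]] c by simp
  then show ?thesis
    using card_subset_eq[OF fin sub] inj_on_cyclic_shift[OF v] by (simp add: bij_betw_def)
qed

text \<open>Puts intersection sizes into the form of indicator sums over positions, in which edges
  are double counted; \<open>k \<le> n\<close> keeps the positions of one segment distinct.\<close>

lemma card_cyclic_segment_Int:
  assumes v: "bij_betw v {..<n} V" and "k \<le> n"
  shows "card (cyclic_segment v n k a \<inter> X) = (\<Sum>x<k. of_bool (v ((a + x) mod n) \<in> X))"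
proof -
  have inj: "inj_on (\<lambda>x. v ((a + x) mod n)) {..<k}"
    using inj_on_subset[OF inj_on_cyclic_shift[OF v]] \<open>k \<le> n\<close> by fastforce
  have "cyclic_segment v n k a \<inter> X = (\<lambda>x. v ((a + x) mod n)) ` {x \<in> {..<k}. v ((a + x) mod n) \<in> X}"
    by (auto simp: cyclic_segment_def)
  then have "card (cyclic_segment v n k a \<inter> X) = card {x \<in> {..<k}. v ((a + x) mod n) \<in> X}"
    using card_image[OF inj_on_subset[OF inj, of "{x \<in> {..<k}. v ((a + x) mod n) \<in> X}"]] by auto
  also have "\<dots> = (\<Sum>x<k. of_bool (v ((a + x) mod n) \<in> X))"
    by (simp add: sum.If_cases of_bool_def Int_def)
  finally show ?thesis .
qed

text \<open>Relative to \<open>a\<close>, the second segment occupies the positions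
  \<open>g\<close>, ..., \<open>g + k - 1\<close> modulo \<open>n\<close>. Its unwrapped part meets
  the first segment in \<open>{g..<k}\<close>, its wrapped part in \<open>{..<k + g - n}\<close>. As
  \<open>2 * k \<le> n\<close>, at most one of the two truncated differences is positive.\<close>

lemma card_cyclic_segment_overlap:
  assumes v: "bij_betw v {..<n} V" and "2 * k \<le> n" "0 < g" "g < n"
  shows "card (cyclic_segment v n k a \<inter> cyclic_segment v n k ((a + g) mod n)) = (k - g) + (k + g - n)"
proof -
  let ?f = "\<lambda>x. v ((a + x) mod n)"
  let ?J = "(\<lambda>x. (g + x) mod n) ` {..<k}"
  have inj: "inj_on ?f {..<n}"
    by (rule inj_on_cyclic_shift[OF v])
  have f_mod: "v (((a + g) mod n + x) mod n) = ?f ((g + x) mod n)" for x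
    by (simp add: mod_simps add.assoc)
  then have "cyclic_segment v n k ((a + g) mod n) = ?f ` ?J"
    unfolding cyclic_segment_def image_image by simp
  moreover have "?f ` {..<k} \<inter> ?f ` ?J = ?f ` ({..<k} \<inter> ?J)"
    using assms by (intro inj_on_image_Int[OF inj, symmetric]) auto
  moreover have "card (?f ` ({..<k} \<inter> ?J)) = card ({..<k} \<inter> ?J)"
    using assms by (intro card_image inj_on_subset[OF inj]) auto
  moreover have "{..<k} \<inter> ?J = {g..<k} \<union> {..<k + g - n}"
  proof (intro set_eqI iffI)
    fix y assume "y \<in> {..<k} \<inter> ?J"
    then obtain x where x: "x < k" "y = (g + x) mod n" "y < k" by auto
    show "y \<in> {g..<k} \<union> {..<k + g - n}"
    proof (cases "g + x < n")
      case False
      then have "y = g + x - n"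
        using x assms by (simp add: mod_if)
      then show ?thesis using x False by auto
    qed (use x in auto)
  next
    fix y assume y: "y \<in> {g..<k} \<union> {..<k + g - n}"
    show "y \<in> {..<k} \<inter> ?J"
    proof (cases "g \<le> y \<and> y < k")
      case True
      then have "y = (g + (y - g)) mod n" "y - g < k"
        using assms by auto
      then show ?thesis using True by blast
    next
      case False
      then have "y < k + g - n" using y by auto
      moreover from this have "y = (g + (y + n - g)) mod n" "y + n - g < k" "y < k"
        using assms by auto
      ultimately show ?thesis by blast
    qed
  qed
  moreover have "card ({g..<k} \<union> {..<k + g - n}) = (k - g) + (k + g - n)"
    using assms by (subst card_Un_disjoint) auto
  ultimately show ?thesis
    by (simp add: cyclic_segment_def)
qed

section \<open>Hamilton cycles\<close>

text \<open>A gap of \<open>n - (k - l)\<close> would leave only \<open>k - l\<close> for all other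
  gaps together, too little for two or more of them. With \<open>N = 2\<close> such a pair of gaps
  would close up, hence \<open>2 < N\<close>.\<close>

lemma l_cycle_gaps:
  fixes s :: "nat \<Rightarrow> nat"
  assumes v: "bij_betw v {..<n} V"
    and "1 \<le> l" "l < k" "2 * k < n" "2 < N"
    and s: "strict_mono_on {..<N} s" "s ` {..<N} \<subseteq> {..<n}"
    and ov: "\<forall>i<N. card (cyclic_segment v n k (s i) \<inter> cyclic_segment v n k (s ((i + 1) mod N))) = l"
  shows "N * (k - l) = n" and "\<And>i. i < N \<Longrightarrow> s i = s 0 + i * (k - l)"
proof -
  let ?m = "k - l"
  \<comment> \<open>Unrolled once around the cycle, the gaps of \<open>S\<close> sum to \<open>n\<close>; each is \<open>k - l\<close> or \<open>n - (k - l)\<close>.\<close>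
  define S where "S i = (if i < N then s i else s 0 + n)" for i
  have s_less: "s i < n" if "i < N" for i
    using s(2) that by auto
  have S_lt: "S i < S (Suc i) \<and> S (Suc i) < S i + n \<and> S (Suc i) mod n = s ((i + 1) mod N)"
    if i: "i < N" for i
  proof (cases "Suc i < N")
    case True
    then have "s i < s (Suc i)"
      using s(1) by (auto simp: strict_mono_on_def)
    then show ?thesis using True i s_less[OF True] by (simp add: S_def)
  next
    case False
    then have "Suc i = N" using i by simp
    moreover have "s 0 < s i"
      using s(1) \<open>2 < N\<close> \<open>Suc i = N\<close> by (auto simp: strict_mono_on_def)
    ultimately show ?thesis
      using i s_less[OF i] s_less[of 0] by (auto simp: S_def)
  qed
  have gap: "S (Suc i) = S i + ?m \<or> S (Suc i) = S i + (n - ?m)" if i: "i < N" for i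
  proof -
    define g where "g = S (Suc i) - S i"
    have g: "0 < g" "g < n" "S (Suc i) = S i + g"
      using S_lt[OF i] by (auto simp: g_def)
    have "s ((i + 1) mod N) = (s i + g) mod n"
      using S_lt[OF i] g i by (simp add: S_def)
    then have "l = (k - g) + (k + g - n)"
      using card_cyclic_segment_overlap[OF v _ g(1,2), of k "s i"] ov i \<open>2 * k < n\<close> by auto
    \<comment> \<open>Since \<open>l \<ge> 1\<close>, exactly one of the two truncated terms is
      positive, and it equals \<open>l\<close>.\<close>
    then have "g = ?m \<or> g = n - ?m"
      using assms g by linarith
    then show ?thesis using g by auto
  qed
  have gap_ge: "S i + ?m \<le> S (Suc i)" if "i < N" for i
    using gap[OF that] assms by auto
  have ge: "S a + b * ?m \<le> S (a + b)" if "a + b \<le> N" for a b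
    using that
  proof (induction b)
    case (Suc b)
    then show ?case using gap_ge[of "a + b"] by simp
  qed simp
  have gap_eq: "S (Suc i) = S i + ?m" if i: "i < N" for i
  proof (rule ccontr)
    assume "\<not> ?thesis"
    then have big: "S (Suc i) = S i + (n - ?m)" using gap[OF i] by auto
    have "S 0 + i * ?m \<le> S i"
      using ge[of 0 i] i by simp
    moreover have "S (Suc i) + (N - Suc i) * ?m \<le> S N"
      using ge[of "Suc i" "N - Suc i"] i by simp
    moreover have "S N = S 0 + n"
      using \<open>2 < N\<close> by (simp add: S_def)
    ultimately have "i * ?m + (N - Suc i) * ?m + (n - ?m) \<le> n"
      using big by linarith
    moreover have "i * ?m + (N - Suc i) * ?m = (N - 1) * ?m"
      using i by (simp flip: add_mult_distrib)
    moreover have "(N - 1) * ?m \<ge> 2 * ?m"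
      using \<open>2 < N\<close> by (intro mult_right_mono) auto
    ultimately show False using assms by linarith
  qed
  have S_eq: "S i = S 0 + i * ?m" if "i \<le> N" for i
    using that
  proof (induction i)
    case (Suc i)
    then show ?case using gap_eq[of i] by simp
  qed simp
  show "N * ?m = n"
    using S_eq[of N] \<open>2 < N\<close> by (simp add: S_def)
  show "s i = s 0 + i * ?m" if "i < N" for i
    using S_eq[of i] that \<open>2 < N\<close> by (simp add: S_def)
qed

text \<open>Each segment contains \<open>q\<close> disjoint blocks of \<open>m\<close> consecutive
  positions. For fixed \<open>c < q\<close>, the \<open>c\<close>-th blocks of all \<open>N\<close>
  segments tile the cycle, because the starts are \<open>m\<close> apart and
  \<open>N * m = n\<close>; together they meet every element of \<open>X\<close> once.\<close>

lemma sum_card_segments_ge: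
  assumes v: "bij_betw v {..<n} V" and "X \<subseteq> V" "q * m \<le> k" "k \<le> n" "N * m = n"
    and s: "\<And>i. i < N \<Longrightarrow> s i = s 0 + i * m"
  shows "q * card X \<le> (\<Sum>i<N. card (cyclic_segment v n k (s i) \<inter> X))"
proof -
  define f where "f a x = (of_bool (v ((a + x) mod n) \<in> X) :: nat)" for a x
  have period: "(\<Sum>x<n. f a x) = card X" for a
  proof -
    have "(\<Sum>x<n. f a x) = (\<Sum>y\<in>V. of_bool (y \<in> X))"
      unfolding f_def by (rule sum.reindex_bij_betw[OF bij_betw_cyclic_shift[OF v]])
    also have "\<dots> = card X"
      using \<open>X \<subseteq> V\<close> bij_betw_finite[OF v] by (simp add: sum.If_cases of_bool_def Int_absorb1)
    finally show ?thesis .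
  qed
  have "q * card X = (\<Sum>c<q. \<Sum>x<N * m. f (s 0 + c * m) x)"
    using period \<open>N * m = n\<close> by simp
  also have "\<dots> = (\<Sum>c<q. \<Sum>i<N. \<Sum>x = i * m..<i * m + m. f (s 0 + c * m) x)"
    by (simp only: sum.nat_group)
  also have "\<dots> = (\<Sum>i<N. \<Sum>c<q. \<Sum>x = i * m..<i * m + m. f (s 0 + c * m) x)"
    by (rule sum.swap)
  \<comment> \<open>Offset \<open>i * m\<close> from \<open>s 0 + c * m\<close> is the same position
    as offset \<open>c * m\<close> from \<open>s i\<close>.\<close>
  also have "\<dots> = (\<Sum>i<N. \<Sum>c<q. \<Sum>x = c * m..<c * m + m. f (s i) x)"
  proof (rule sum.cong[OF refl], rule sum.cong[OF refl])
    fix i c assume "i \<in> {..<N}" "c \<in> {..<q}"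
    then have si: "s i = s 0 + i * m" by (intro s) simp
    have "(\<Sum>x = i * m..<i * m + m. f (s 0 + c * m) x) = (\<Sum>x<m. f (s 0 + c * m) (x + i * m))"
      using sum.shift_bounds_nat_ivl[of "f (s 0 + c * m)" 0 "i * m" m]
      by (simp add: atLeast0LessThan add.commute)
    also have "\<dots> = (\<Sum>x<m. f (s i) (x + c * m))"
      by (simp add: f_def si ac_simps)
    also have "\<dots> = (\<Sum>x = c * m..<c * m + m. f (s i) x)"
      using sum.shift_bounds_nat_ivl[of "f (s i)" 0 "c * m" m]
      by (simp add: atLeast0LessThan add.commute)
    finally show "(\<Sum>x = i * m..<i * m + m. f (s 0 + c * m) x) = (\<Sum>x = c * m..<c * m + m. f (s i) x)" .
  qed
  also have "\<dots> = (\<Sum>i<N. \<Sum>x<q * m. f (s i) x)"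
    by (simp only: sum.nat_group)
  also have "\<dots> \<le> (\<Sum>i<N. \<Sum>x<k. f (s i) x)"
    using \<open>q * m \<le> k\<close> by (intro sum_mono sum_mono2) auto
  also have "\<dots> = (\<Sum>i<N. card (cyclic_segment v n k (s i) \<inter> X))"
    using card_cyclic_segment_Int[OF v \<open>k \<le> n\<close>] by (simp add: f_def)
  finally show ?thesis .
qed

lemma card_Int_le_Int_plus:
  assumes "finite e" "finite e'" "card e = k" "card (e \<inter> e') = l"
  shows "card (e \<inter> A) \<le> card (e' \<inter> A) + (k - l)"
proof -
  have "e \<inter> A \<subseteq> (e' \<inter> A) \<union> (e - e')" by auto
  then have "card (e \<inter> A) \<le> card ((e' \<inter> A) \<union> (e - e'))"
    using assms by (intro card_mono) auto
  also have "\<dots> \<le> card (e' \<inter> A) + card (e - e')" by (rule card_Un_le)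
  also have "card (e - e') = k - l"
    using assms by (simp add: card_Diff_subset_Int)
  finally show ?thesis .
qed

text \<open>Below the window, \<open>card (e \<inter> A) \<le> j - 1 < q * m / 2\<close> with
  \<open>q = k div m\<close>. Above it, \<open>card (e - A) \<le> k - j - m\<close>, which is also
  less than \<open>q * m / 2\<close> because \<open>k < q * m + m\<close>. Neither is compatible
  with the averages over all edges.\<close>

lemma no_hamilton_l_cycle:
  fixes k l :: nat
  defines "m \<equiv> k - l"
  defines "j \<equiv> ((k div m) * m + 1) div 2"
  assumes "1 \<le> l" "l < k" "2 * k < card V" "A \<subseteq> V" "card A = card V div 2"
    and E: "\<And>e. e \<in> E \<Longrightarrow> card (e \<inter> A) \<notin> {j..<j + m}"
  shows "\<not> has_hamilton_l_cycle k l V E"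
proof
  assume "has_hamilton_l_cycle k l V E"
  then obtain C where C: "C \<subseteq> E" "l_cycle k l V C"
    unfolding has_hamilton_l_cycle_def by blast
  then have "kgraph k V C" and UC: "\<Union>C = V"
    by (simp_all add: l_cycle_def)
  from C(2) obtain v s where v: "bij_betw v {..<card V} V"
    and s: "strict_mono_on {..<card C} s" "s ` {..<card C} \<subseteq> {..<card V}"
    and Ceq: "C = (\<lambda>i. cyclic_segment v (card V) k (s i)) ` {..<card C}"
    and ov: "\<forall>i<card C. card (cyclic_segment v (card V) k (s i) \<inter>
                          cyclic_segment v (card V) k (s ((i + 1) mod card C))) = l"
    unfolding l_cycle_def by (elim conjE exE)
  define n N q where "n = card V" and "N = card C" and "q = k div m"
  define e where "e i = cyclic_segment v n k (s i)" for i
  define c where "c i = card (e i \<inter> A)" for i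
  have e_in: "e i \<in> C" if "i < N" for i
    using Ceq that unfolding e_def n_def N_def by blast
  have finV: "finite V" and Csub: "C \<subseteq> nsets V k"
    using \<open>kgraph k V C\<close> by (auto simp: kgraph_def)
  have e: "finite (e i)" "card (e i) = k" "e i \<subseteq> V" if "i < N" for i
    using e_in[OF that] Csub by (auto simp: nsets_def)
  \<comment> \<open>The edges cover \<open>V\<close>, so \<open>2 * k < n\<close> forces more than
    two of them, as \<open>l_cycle_gaps\<close> requires.\<close>
  have "n \<le> N * k"
  proof -
    have "n \<le> (\<Sum>x\<in>C. card x)"
      using card_Union_le_sum_card[of C] UC by (simp add: n_def)
    also have "\<dots> = N * k"
      using Csub by (simp add: N_def nsets_def subset_iff)
    finally show ?thesis .
  qed
  then have "2 * k < N * k" using assms n_def by linarith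
  then have "2 < N" by simp
  note gaps = l_cycle_gaps[OF v \<open>1 \<le> l\<close> \<open>l < k\<close> \<open>2 * k < card V\<close> \<open>2 < N\<close>[unfolded N_def] s ov,
      folded n_def N_def m_def]
  have m: "0 < m" "m \<le> k" using assms by (auto simp: m_def)
  have qm: "q * m \<le> k" "k < q * m + m"
    using m by (auto simp: q_def) (metis dividend_less_div_times add.commute)
  have "0 < q" using m by (simp add: q_def div_greater_zero_iff)
  have j: "2 * j \<le> q * m + 1" "q * m \<le> 2 * j" "0 < j"
    using \<open>0 < q\<close> m by (auto simp: j_def q_def[symmetric] Suc_le_eq div_greater_zero_iff)
  have "k \<le> n" using assms n_def by simp
  note sums = sum_card_segments_ge[OF v[folded n_def] _ qm(1) \<open>k \<le> n\<close> gaps, folded e_def]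
  have c_out: "c i < j \<or> j + m \<le> c i" if "i < N" for i
    using E[of "e i"] C(1) e_in[OF that] by (auto simp: c_def)
  have step: "c i \<le> c (Suc i) + m \<and> c (Suc i) \<le> c i + m" if "Suc i < N" for i
  proof -
    have "card (e i \<inter> e (Suc i)) = l"
      using ov[rule_format, of i] that by (simp add: e_def n_def N_def)
    then show ?thesis
      using card_Int_le_Int_plus[of "e i" "e (Suc i)" k l A] card_Int_le_Int_plus[of "e (Suc i)" "e i" k l A]
        e[of i] e[of "Suc i"] that by (simp add: c_def m_def Int_commute)
  qed
  \<comment> \<open>Crossing the window would need a jump between at most \<open>j - 1\<close> and
    at least \<open>j + m\<close>, which exceeds the step bound \<open>m\<close>.\<close>
  have same: "c i < j \<longleftrightarrow> c 0 < j" if "i < N" for i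
    using that
  proof (induction i)
    case (Suc i)
    then show ?case using step[of i] c_out[of i] c_out[of "Suc i"] by force
  qed simp
  have Nm: "N * m = n" by (rule gaps(1))
  show False
  proof (cases "c 0 < j")
    case True
    have "q * (n div 2) \<le> (\<Sum>i<N. c i)"
      using sums[OF \<open>A \<subseteq> V\<close>] assms by (simp add: c_def n_def)
    also have "\<dots> \<le> (\<Sum>i<N. j - 1)"
      using same True by (intro sum_mono) fastforce
    finally have "q * (n div 2) \<le> N * (j - 1)" by simp
    \<comment> \<open>An odd \<open>n\<close> costs at most \<open>q\<close> through rounding, while
      \<open>2 * (j - 1) \<le> q * m - 1\<close> gains \<open>N\<close>. Hence
      \<open>N \<le> q\<close>, although \<open>N * m = n > k \<ge> q * m\<close>.\<close>
    moreover have "q * n \<le> q * (2 * (n div 2) + 1)" by (intro mult_left_mono) auto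
    ultimately have "q * n \<le> N * (2 * (j - 1)) + q" by (simp add: algebra_simps)
    also have "N * (2 * (j - 1)) \<le> N * (q * m - 1)"
      using j by (intro mult_left_mono) auto
    also have "N * (q * m - 1) = q * n - N"
      using Nm by (auto simp: algebra_simps)
    finally have "q * n \<le> q * n - N + q" by simp
    moreover have "N \<le> q * n"
      using Nm m \<open>0 < q\<close> by (metis mult.assoc mult.commute mult_le_mono1 mult_1 nat_0_less_mult_iff Suc_leI One_nat_def)
    ultimately have "N \<le> q" by linarith
    then have "N * m \<le> q * m" by simp
    then show False using Nm qm assms n_def by linarith
  next
    case False
    \<comment> \<open>The complement of \<open>A\<close> has at least \<open>n / 2\<close> elements,
      so here rounding causes no loss.\<close>
    define B where "B = V - A"
    have cB: "card (e i \<inter> B) + (j + m) \<le> k" if "i < N" for i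
    proof -
      have "e i \<inter> B = e i - e i \<inter> A" using e(3)[OF that] by (auto simp: B_def)
      then have "card (e i \<inter> B) = k - c i"
        using e[OF that] by (simp add: card_Diff_subset c_def)
      moreover have "c i \<le> k"
        using e[OF that] by (metis c_def card_mono inf_le1)
      ultimately show ?thesis using c_out[OF that] same[OF that] False by auto
    qed
    have "q * card B \<le> (\<Sum>i<N. card (e i \<inter> B))"
      using sums[of B] by (auto simp: B_def)
    also have "\<dots> \<le> (\<Sum>i<N. k - (j + m))"
      using cB by (intro sum_mono) fastforce
    finally have *: "q * card B \<le> N * (k - (j + m))" by simp
    have "card B = n - n div 2"
      using assms finite_subset[OF \<open>A \<subseteq> V\<close> finV] by (simp add: B_def n_def card_Diff_subset)
    then have "n \<le> 2 * card B" by linarith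
    then have "q * n \<le> q * (2 * card B)" by (rule mult_left_mono) simp
    also have "\<dots> \<le> N * (2 * (k - (j + m)))"
      using * by (metis mult.left_commute mult_le_mono2)
    finally have "N * (q * m) \<le> N * (2 * (k - (j + m)))"
      unfolding Nm[symmetric] by (simp only: mult.left_commute)
    then have "q * m \<le> 2 * (k - (j + m))" using \<open>2 < N\<close> by simp
    moreover have "j + m \<le> k" using cB[of 0] \<open>2 < N\<close> by simp
    ultimately show False using j qm by linarith
  qed
qed

section \<open>Degrees\<close>

lemma window_sum_le_max_binomial_sum:
  assumes "m \<le> t + 1"
  shows "(\<Sum>u | u \<le> t \<and> i + u \<in> {j..<j + m}. t choose u) \<le> max_binomial_sum t m"
proof -
  \<comment> \<open>The shifted window may stick out of \<open>{..t}\<close>. Truncated subtraction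
    moves a start below 0 up to 0, and \<open>min\<close> moves a window reaching beyond
    \<open>t\<close> back so that it ends at \<open>t\<close>; the part inside \<open>{..t}\<close>
    stays covered.\<close>
  define a where "a = min (j - i) (t + 1 - m)"
  have a: "a + m \<le> t + 1" using assms by (auto simp: a_def)
  have "(\<Sum>u | u \<le> t \<and> i + u \<in> {j..<j + m}. t choose u) \<le> (\<Sum>u = a..<a + m. t choose u)"
    using assms by (intro sum_mono2) (auto simp: a_def)
  also have "\<dots> \<le> max_binomial_sum t m"
    unfolding max_binomial_sum_def
  proof (rule Max_ge)
    have "{(\<Sum>i = j..<j + m. t choose i) |j. j + m \<le> t + 1}
        \<subseteq> (\<lambda>j. \<Sum>i = j..<j + m. t choose i) ` {..t + 1}" by auto
    then show "finite {(\<Sum>i = j..<j + m. t choose i) |j. j + m \<le> t + 1}"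
      by (rule finite_subset) simp
  qed (use a in auto)
  finally show ?thesis .
qed

lemma card_nsets_Int_eq_le:
  assumes "finite V" "A \<subseteq> V" "u \<le> t"
  shows "card {T \<in> nsets V t. card (T \<inter> A) = u} \<le> (card A choose u) * (card (V - A) choose (t - u))"
proof -
  let ?F = "{T \<in> nsets V t. card (T \<inter> A) = u}"
  have finA: "finite A" using assms finite_subset by auto
  have "inj_on (\<lambda>T. (T \<inter> A, T - A)) ?F"
    by (rule inj_onI) auto
  moreover have "(\<lambda>T. (T \<inter> A, T - A)) ` ?F \<subseteq> nsets A u \<times> nsets (V - A) (t - u)"
    using finA by (auto simp: nsets_def card_Diff_subset_Int)
  moreover have "finite (nsets A u \<times> nsets (V - A) (t - u))"
    using finA assms by (simp add: finite_imp_finite_nsets)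
  ultimately have "card ?F \<le> card (nsets A u \<times> nsets (V - A) (t - u))"
    by (rule card_inj_on_le)
  then show ?thesis by (simp add: card_cartesian_product)
qed

lemma binomial_le_pow_div_fact:
  assumes "real a \<le> x"
  shows "real (a choose u) \<le> x ^ u / fact u"
proof -
  have "real (a choose u) * fact u \<le> real a ^ u"
    using binomial_fact_pow[of a u] by (metis of_nat_fact of_nat_le_iff of_nat_mult of_nat_power)
  also have "\<dots> \<le> x ^ u" using assms by (intro power_mono) auto
  finally show ?thesis by (simp add: field_simps)
qed

lemma binomial_ge_pow_div_fact:
  assumes "t \<le> n"
  shows "(real n - real t) ^ t / fact t \<le> real (n choose t)"
proof -
  have "(real n - real t) ^ t = (\<Prod>i<t. real n - real t)" by simp
  also have "\<dots> \<le> (\<Prod>i<t. real n - real i)"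
    using assms by (intro prod_mono) auto
  also have "\<dots> = real (n choose t) * fact t"
    by (simp add: binomial_gbinomial gbinomial_prod_rev atLeast0LessThan)
  finally show ?thesis by (simp add: field_simps)
qed

text \<open>With the same bound \<open>x\<close> for both sides of the partition, the sets meeting
  \<open>A\<close> in \<open>u\<close> elements number at most
  \<open>x ^ u / fact u * (x ^ (t - u) / fact (t - u))\<close>, which is \<open>t choose u\<close>
  times \<open>x ^ t / fact t\<close>. Only a window of binomial coefficients remains to be
  summed.\<close>

lemma card_window_sets_le:
  assumes "finite V" "A \<subseteq> V" "m \<le> t + 1"
    and "real (card A) \<le> x" "real (card (V - A)) \<le> x"
  shows "real (card {T \<in> nsets V t. i + card (T \<inter> A) \<in> {j..<j + m}})
    \<le> real (max_binomial_sum t m) * (x ^ t / fact t)"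
proof -
  let ?U = "{u. u \<le> t \<and> i + u \<in> {j..<j + m}}"
  let ?F = "\<lambda>u. {T \<in> nsets V t. card (T \<inter> A) = u}"
  have x: "0 \<le> x" using assms(4) by linarith
  have "{T \<in> nsets V t. i + card (T \<inter> A) \<in> {j..<j + m}} \<subseteq> (\<Union>u\<in>?U. ?F u)"
    by (auto simp: nsets_def card_mono)
  then have "card {T \<in> nsets V t. i + card (T \<inter> A) \<in> {j..<j + m}} \<le> card (\<Union>u\<in>?U. ?F u)"
    using assms(1) by (intro card_mono) (auto simp: finite_imp_finite_nsets)
  also have "\<dots> \<le> (\<Sum>u\<in>?U. card (?F u))"
    by (rule card_UN_le) simp
  finally have "real (card {T \<in> nsets V t. i + card (T \<inter> A) \<in> {j..<j + m}}) \<le> (\<Sum>u\<in>?U. real (card (?F u)))"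
    by (simp flip: of_nat_sum)
  also have "\<dots> \<le> (\<Sum>u\<in>?U. real (t choose u) * (x ^ t / fact t))"
  proof (rule sum_mono)
    fix u assume "u \<in> ?U"
    then have u: "u \<le> t" by simp
    have "real (card (?F u)) \<le> real (card A choose u) * real (card (V - A) choose (t - u))"
      using card_nsets_Int_eq_le[OF assms(1,2) u] by (simp flip: of_nat_mult)
    also have "\<dots> \<le> (x ^ u / fact u) * (x ^ (t - u) / fact (t - u))"
      using x assms by (intro mult_mono binomial_le_pow_div_fact) auto
    also have "\<dots> = real (t choose u) * (x ^ t / fact t)"
      using u by (simp add: binomial_fact flip: power_add)
    finally show "real (card (?F u)) \<le> real (t choose u) * (x ^ t / fact t)" .
  qed
  also have "\<dots> = real (\<Sum>u\<in>?U. t choose u) * (x ^ t / fact t)"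
    by (simp add: sum_distrib_right sum_divide_distrib)
  also have "\<dots> \<le> real (max_binomial_sum t m) * (x ^ t / fact t)"
    using window_sum_le_max_binomial_sum[OF assms(3), of i j] x
    by (intro mult_right_mono) (auto simp del: of_nat_sum)
  finally show ?thesis .
qed

text \<open>Removing \<open>S\<close> from an edge shifts the window by
  \<open>card (S \<inter> A)\<close>. The lost sets are counted among all
  \<open>(k - d)\<close>-subsets of \<open>V\<close>, and the maximum over windows absorbs the
  shift, so the bound is uniform in \<open>S\<close>.\<close>

lemma hdegree_window_ge:
  assumes "finite V" "A \<subseteq> V" "k - d + 1 \<ge> m" "d \<le> k" "S \<in> nsets V d"
    and "real (card A) \<le> x" "real (card (V - A)) \<le> x"
  shows "real ((card V - d) choose (k - d)) - real (max_binomial_sum (k - d) m) * (x ^ (k - d) / fact (k - d))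
    \<le> real (hdegree {e \<in> nsets V k. card (e \<inter> A) \<notin> {j..<j + m}} S)"
proof -
  define t where "t = k - d"
  let ?all = "{e \<in> nsets V k. S \<subseteq> e}"
  let ?bad = "{e \<in> nsets V k. S \<subseteq> e \<and> card (e \<inter> A) \<in> {j..<j + m}}"
  let ?good = "{e \<in> {e \<in> nsets V k. card (e \<inter> A) \<notin> {j..<j + m}}. S \<subseteq> e}"
  have S: "S \<subseteq> V" "finite S" "card S = d" using assms by (auto simp: nsets_def)
  have fin: "finite (nsets V r)" for r using assms(1) by (rule finite_imp_finite_nsets)
  have "card (nsets (V - S) t) \<le> card ?all"
  proof (rule card_inj_on_le[where f = "\<lambda>T. T \<union> S"])
    show "inj_on (\<lambda>T. T \<union> S) (nsets (V - S) t)"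
      by (rule inj_onI) (auto simp: nsets_def)
    show "(\<lambda>T. T \<union> S) ` nsets (V - S) t \<subseteq> ?all"
    proof (rule image_subsetI)
      fix T assume T: "T \<in> nsets (V - S) t"
      then have "card (T \<union> S) = t + d"
        using S by (subst card_Un_disjoint) (auto simp: nsets_def)
      then show "T \<union> S \<in> ?all" using T S assms by (auto simp: nsets_def t_def)
    qed
  qed (use fin in auto)
  then have all: "(card V - d) choose t \<le> card ?all"
    using S by (simp add: card_Diff_subset)
  have "card ?bad \<le> card {T \<in> nsets V t. card (S \<inter> A) + card (T \<inter> A) \<in> {j..<j + m}}"
  proof (rule card_inj_on_le[where f = "\<lambda>e. e - S"])
    show "inj_on (\<lambda>e. e - S) ?bad"
      by (rule inj_onI) auto
    show "(\<lambda>e. e - S) ` ?bad \<subseteq> {T \<in> nsets V t. card (S \<inter> A) + card (T \<inter> A) \<in> {j..<j + m}}"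
    proof (rule image_subsetI)
      fix e assume e: "e \<in> ?bad"
      have "e \<inter> A = (S \<inter> A) \<union> ((e - S) \<inter> A)" using e by auto
      then have "card (e \<inter> A) = card (S \<inter> A) + card ((e - S) \<inter> A)"
        using e S by (simp only:, subst card_Un_disjoint) (auto simp: nsets_def)
      then show "e - S \<in> {T \<in> nsets V t. card (S \<inter> A) + card (T \<inter> A) \<in> {j..<j + m}}"
        using e S by (auto simp: nsets_def t_def card_Diff_subset)
    qed
  qed (use fin in auto)
  then have bad: "real (card ?bad) \<le> real (max_binomial_sum t m) * (x ^ t / fact t)"
    using card_window_sets_le[OF assms(1,2) _ assms(6,7), of m t "card (S \<inter> A)" j] assms(3)
    unfolding t_def by linarith
  have "?all = ?good \<union> ?bad" by auto
  then have "card ?all \<le> card ?good + card ?bad" by (simp only: card_Un_le)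
  with all bad show ?thesis unfolding hdegree_def t_def by linarith
qed

section \<open>The threshold\<close>

text \<open>For \<open>d > card V\<close> the minimum degree is the \<open>Min\<close> of the empty set, and the \<open>LEAST\<close> in the
  threshold need not exist.\<close>

lemma min_degree_less_hamilton_threshold:
  fixes V :: "nat set"
  assumes H: "kgraph k V E" "\<not> has_hamilton_l_cycle k l V E" and "d \<le> card V"
  shows "min_degree d V E < hamilton_threshold d l k (card V)"
proof -
  let ?P = "\<lambda>h. \<forall>(W :: nat set) F. kgraph k W F \<and> card W = card V \<and> min_degree d W F \<ge> h
        \<longrightarrow> has_hamilton_l_cycle k l W F"
  have "min_degree d W F \<le> card V choose k" if WF: "kgraph k W F" "card W = card V" for W F
  proof -
    have fin: "finite W" "F \<subseteq> nsets W k" using WF by (auto simp: kgraph_def)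
    obtain S where "S \<subseteq> W" "card S = d" "finite S"
      using obtain_subset_with_card_n[of d W] \<open>d \<le> card V\<close> WF(2) by metis
    then have "S \<in> nsets W d" by (simp add: nsets_def)
    then have "min_degree d W F \<le> hdegree F S"
      unfolding min_degree_def using fin by (intro Min_le) (auto simp: finite_imp_finite_nsets)
    also have "\<dots> \<le> card (nsets W k)"
      unfolding hdegree_def using fin by (intro card_mono) (auto simp: finite_imp_finite_nsets)
    finally show ?thesis using WF by simp
  qed
  \<comment> \<open>Beyond every possible minimum degree the condition holds vacuously, so the
    \<open>LEAST\<close> is attained.\<close>
  then have "?P (Suc (card V choose k))" by fastforce
  then have "?P (hamilton_threshold d l k (card V))"
    unfolding hamilton_threshold_def by (rule LeastI)
  then have "\<not> hamilton_threshold d l k (card V) \<le> min_degree d V E"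
    using H by blast
  then show ?thesis by simp
qed

text \<open>A bound for each single \<open>n\<close>, from which the asymptotics follow. The base
  \<open>(n + 1) / 2\<close> bounds both halves of the vertex set whatever the parity of
  \<open>n\<close>.\<close>

lemma hamilton_threshold_ge:
  assumes "1 \<le> d" "d \<le> l" "l < k" "2 * k < n"
  shows "(real n - real k) ^ (k - d) / fact (k - d)
      - real (max_binomial_sum (k - d) (k - l)) * (((real n + 1) / 2) ^ (k - d) / fact (k - d))
    \<le> real (hamilton_threshold d l k n)"
proof -
  define t m j where "t = k - d" and "m = k - l" and "j = ((k div m) * m + 1) div 2"
  define V A where "V = {..<n}" and "A = {..<n div 2}"
  define E where "E = {e \<in> nsets V k. card (e \<inter> A) \<notin> {j..<j + m}}"
  have V: "finite V" "card V = n" "A \<subseteq> V" "card A = n div 2"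
    by (auto simp: V_def A_def)
  have VA: "card (V - A) = n - n div 2"
    using V finite_subset[OF V(3)] by (simp add: card_Diff_subset)
  have "\<not> has_hamilton_l_cycle k l V E"
  proof (rule no_hamilton_l_cycle)
    show "\<And>e. e \<in> E \<Longrightarrow> card (e \<inter> A) \<notin> {(k div (k - l) * (k - l) + 1) div 2..<
        (k div (k - l) * (k - l) + 1) div 2 + (k - l)}"
      by (simp add: E_def j_def m_def)
  qed (use assms V in auto)
  then have less: "min_degree d V E < hamilton_threshold d l k n"
    using min_degree_less_hamilton_threshold[of k V E l d] V assms by (auto simp: kgraph_def E_def)
  have "min_degree d V E \<in> hdegree E ` nsets V d"
    unfolding min_degree_def
  proof (rule Min_in)
    show "finite (hdegree E ` nsets V d)" using V by (simp add: finite_imp_finite_nsets)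
    have "{..<d} \<in> nsets V d" using assms by (auto simp: V_def nsets_def)
    then show "hdegree E ` nsets V d \<noteq> {}" by auto
  qed
  then obtain S where S: "S \<in> nsets V d" "min_degree d V E = hdegree E S" by auto
  \<comment> \<open>The base is \<open>n - k\<close> because
    \<open>(n - d) - t = n - k\<close>.\<close>
  have "(real n - real k) ^ t / fact t \<le> real ((n - d) choose t)"
    using binomial_ge_pow_div_fact[of t "n - d"] assms by (simp add: t_def of_nat_diff)
  moreover have "real ((n - d) choose t) - real (max_binomial_sum t m) * (((real n + 1) / 2) ^ t / fact t)
      \<le> real (hdegree E S)"
    unfolding E_def t_def V(2)[symmetric] using V VA assms
    by (intro hdegree_window_ge[OF V(1,3) _ _ S(1)]) (auto simp: m_def)
  ultimately show ?thesis using less S(2) unfolding t_def m_def by linarith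
qed

theorem theorem1p5:
  fixes k d l t :: nat
  assumes "1 \<le> d" and "d \<le> l" and "l \<le> k - 1" and "t = k - d"
  shows "\<exists>\<epsilon> :: nat \<Rightarrow> real. \<epsilon> \<longlonglongrightarrow> 0 \<and>
    (\<forall>n. (k - l) dvd n \<longrightarrow>
      real (hamilton_threshold d l k n) \<ge>
        (1 - real (max_binomial_sum t (k - l)) / 2 ^ t + \<epsilon> n) * real (n choose t))"
proof -
  define \<beta> where "\<beta> = real (max_binomial_sum t (k - l)) / 2 ^ t"
  \<comment> \<open>The denominators are chosen to cancel against
    \<open>n choose t \<le> n ^ t / fact t\<close> in the first term and
    \<open>n choose t \<ge> (n - t) ^ t / fact t\<close> in the subtracted one, leaving exactly the
    bound of \<open>hamilton_threshold_ge\<close>.\<close>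
  define r where "r n = ((real n - real k) / real n) ^ t
      - \<beta> * ((real n + 1) / (real n - real t)) ^ t" for n
  \<comment> \<open>For \<open>n \<le> 2 * k\<close> this value makes the coefficient of
    \<open>n choose t\<close> zero, so the claim is trivial there.\<close>
  define \<epsilon> where "\<epsilon> n = (if 2 * k < n then r n else 0) - (1 - \<beta>)" for n
  have "(\<lambda>n. (real n - real k) / real n) \<longlonglongrightarrow> 1" "(\<lambda>n. (real n + 1) / (real n - real t)) \<longlonglongrightarrow> 1"
    by real_asymp+
  then have "r \<longlonglongrightarrow> 1 ^ t - \<beta> * 1 ^ t"
    unfolding r_def by (intro tendsto_intros)
  then have "(\<lambda>n. r n - (1 - \<beta>)) \<longlonglongrightarrow> 0"
    using LIM_zero by fastforce
  moreover have "\<forall>\<^sub>F n in sequentially. r n - (1 - \<beta>) = \<epsilon> n"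
    using eventually_gt_at_top[of "2 * k"] by eventually_elim (simp add: \<epsilon>_def)
  ultimately have "\<epsilon> \<longlonglongrightarrow> 0"
    by (rule Lim_transform_eventually)
  moreover have "(1 - \<beta> + \<epsilon> n) * real (n choose t) \<le> real (hamilton_threshold d l k n)" for n
  proof (cases "2 * k < n")
    case True
    have lk: "l < k" using assms by linarith
    have tn: "t < n" "0 < n" using True assms by auto
    have "(1 - \<beta> + \<epsilon> n) * real (n choose t) = ((real n - real k) / real n) ^ t * real (n choose t)
        - \<beta> * (((real n + 1) / (real n - real t)) ^ t * real (n choose t))"
      using True by (simp add: \<epsilon>_def r_def algebra_simps)
    also have "\<dots> \<le> ((real n - real k) / real n) ^ t * (real n ^ t / fact t)
        - \<beta> * (((real n + 1) / (real n - real t)) ^ t * ((real n - real t) ^ t / fact t))"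
      using True tn by (intro diff_mono mult_left_mono binomial_le_pow_div_fact binomial_ge_pow_div_fact)
        (auto simp: \<beta>_def)
    also have "\<dots> = (real n - real k) ^ t / fact t - \<beta> * ((real n + 1) ^ t / fact t)"
      using tn by (simp add: power_divide)
    also have "\<dots> \<le> real (hamilton_threshold d l k n)"
      using hamilton_threshold_ge[OF assms(1,2) lk True] assms(4)
      by (simp add: \<beta>_def power_divide)
    finally show ?thesis .
  qed (simp add: \<epsilon>_def)
  ultimately show ?thesis
    unfolding \<beta>_def by blast
qed

end
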